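(* Let $(\mathrm{P})$ be the linear infinite problem $\inf\langle x^*,x\rangle$ s.t. $\langle a_t^*,x\rangle\le b_t$, $t\in T$, and let $\emptyset\ne\mathcal{H}\subset\mathcal{F}(T)$. Assume that $(\mathrm{P})$ is bounded, i.e. $\alpha:=\inf(\mathrm{P})\in\mathbb{R}$, and that $$\forall H\in\mathcal{H},\ \exists a_H\in X\ \text{ such that }\ \langle a_t^*,a_H\rangle<b_t,\ \forall t\in H.$$ Then the following statements are equivalent: (i) $-(x^*,\alpha)\in\mathcal{K}_{\mathcal{H}}$. (ii) $\mathcal{H}$-strong duality holds, i.e. $\alpha=\max(\mathrm{D}_{\mathcal{H}})$. (iii) $(\mathrm{D})$ is $\mathcal{H}$-reducible and zero $\mathcal{H}$-duality holds, i.e. $\alpha=\sup(\mathrm{D}_{\mathcal{H}})$ (entailing $\alpha=\sup(\mathrm{D})$). (iv) $(\mathrm{P})$ is $\mathcal{H}$-reducible.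
   Context: $X$ is a locally convex Hausdorff (real) topological vector space with topological dual $X^*$; $T$ is an infinite index set; $x^*\in X^*$, $a_t^*\in X^*$ and $b_t\in\mathbb{R}$ for $t\in T$. $\mathcal{F}(T)$ is the family of all non-empty finite subsets of $T$. For non-empty $A$, $\operatorname{cone}(A):=\{\mu z:\mu\ge 0,\ z\in\operatorname{co}A\}$, where $\operatorname{co}$ is the convex hull. For $H\in\mathcal{F}(T)$: - $(\mathrm{P}_H)$: $\inf\langle x^*,x\rangle$ s.t. $\langle a_t^*,x\rangle\le b_t$, $t\in H$. - $(\mathrm{D}_H)$: $\sup\,-\sum_{t\in H}\mu_tb_t$ s.t. $\mu\in\mathbb{R}_+^H$, $\sum_{t\in H}\mu_ta_t^*=-x^*$. - $(\mathrm{D}_{\mathcal{H}})$: $\sup\,-\sum_{t\in H}\mu_tb_t$ s.t. $H\in\mathcal{H}$, $\mu\in\mathbb{R}_+^H$, $\sum_{t\in H}\mu_ta_t^*=-x^*$. - $(\mathrm{D})$: $\sup\,-\sum_{t\in T}\lambda_tb_t$ s.t. $\lambda\in\mathbb{R}_+^{(T)}$, $\sum_{t\in T}\lambda_ta_t^*=-x^*$, where $\mathbb{R}_+^{(T)}$ is the set of finitely supported functions $\lambda:T\to\mathbb{R}_+$. (Supremum over the empty set is $-\infty$.) Writing $\max$ instead of $\sup$ means the supremum is attained. $\mathcal{K}_{\mathcal{H}}:=\bigcup_{H\in\mathcal{H}}\operatorname{cone}\left(\{(a_t^*,b_t):t\in H\}+\{0_{X^*}\}\times\mathbb{R}_+\right)\subset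 X^*\times\mathbb{R}$. $(\mathrm{P})$ (resp. $(\mathrm{D})$) is $\mathcal{H}$-reducible if there exists $H\in\mathcal{H}$ such that $\inf(\mathrm{P})=\inf(\mathrm{P}_H)$ (resp. $\sup(\mathrm{D})=\sup(\mathrm{D}_H)$). *)

theory Defs
  imports "HOL-Analysis.Analysis" "HOL-Library.FuncSet" "HOL-Library.Set_Algebras"
begin

text \<open>Locally convex Hausdorff real topological vector spaces. Continuity of addition and of
  negation comes from \<^class>\<open>topological_group_add\<close>, the Hausdorff property from \<^class>\<open>t2_space\<close>.
  Convexity is unfolded in the last axiom because \<^const>\<open>convex\<close> cannot be used inside a class
  specification.\<close>

class locally_convex_t2 = real_vector + topological_group_add + t2_space +
  assumes tendsto_scaleR_nhds_Pair:
    "\<And>(c::real) x. LIM p (nhds c \<times>\<^sub>F nhds x). fst p *\<^sub>R snd p :> nhds (c *\<^sub>R x)"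
  and convex_nhds_base:
    "\<And>x U. open U \<Longrightarrow> x \<in> U \<Longrightarrow> \<exists>C. open C \<and>
      (\<forall>y\<in>C. \<forall>z\<in>C. \<forall>u\<ge>0. \<forall>v\<ge>0. u + v = 1 \<longrightarrow> u *\<^sub>R y + v *\<^sub>R z \<in> C) \<and>
      x \<in> C \<and> C \<subseteq> U"

lemma locally_convex_base:
  fixes x :: "'a::locally_convex_t2"
  assumes "open U" "x \<in> U"
  shows "\<exists>C. open C \<and> convex C \<and> x \<in> C \<and> C \<subseteq> U"
  using convex_nhds_base[OF assms] unfolding convex_def .

text \<open>The topological dual, as a real vector space. It is given no topology, since only algebraic
  convex and conical hulls are taken in it.\<close>

typedef (overloaded) 'a top_dual =
  "{f :: 'a::{real_vector, topological_space} \<Rightarrow> real. linear f \<and> continuous_on UNIV f}"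
  morphisms pairing Abs_top_dual
proof
  show "(\<lambda>_. 0) \<in> {f :: 'a \<Rightarrow> real. linear f \<and> continuous_on UNIV f}"
    by (simp add: linear_iff)
qed

setup_lifting type_definition_top_dual

instantiation top_dual :: ("{real_vector, topological_space}") real_vector
begin

lift_definition zero_top_dual :: "'a top_dual" is "\<lambda>_. 0"
  by (simp add: linear_iff)

lift_definition plus_top_dual :: "'a top_dual \<Rightarrow> 'a top_dual \<Rightarrow> 'a top_dual"
  is "\<lambda>f g x. f x + g x"
  by (auto simp: linear_iff algebra_simps intro!: continuous_intros)

lift_definition minus_top_dual :: "'a top_dual \<Rightarrow> 'a top_dual \<Rightarrow> 'a top_dual"
  is "\<lambda>f g x. f x - g x"
  by (auto simp: linear_iff algebra_simps intro!: continuous_intros)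

lift_definition uminus_top_dual :: "'a top_dual \<Rightarrow> 'a top_dual"
  is "\<lambda>f x. - f x"
  by (auto simp: linear_iff algebra_simps intro!: continuous_intros)

lift_definition scaleR_top_dual :: "real \<Rightarrow> 'a top_dual \<Rightarrow> 'a top_dual"
  is "\<lambda>c f x. c * f x"
  by (auto simp: linear_iff algebra_simps intro!: continuous_intros)

instance
  by standard (transfer; auto simp: algebra_simps fun_eq_iff)+

end

definition fin_nonempty_subsets :: "'t set \<Rightarrow> 't set set" where
  "fin_nonempty_subsets T = {H. H \<subseteq> T \<and> finite H \<and> H \<noteq> {}}"

definition cone_co :: "'v::real_vector set \<Rightarrow> 'v set" where
  "cone_co A = {\<mu> *\<^sub>R z | \<mu> z. 0 \<le> \<mu> \<and> z \<in> convex hull A}"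

text \<open>The optimal value of the primal problem with constraint index set \<open>S\<close>: \<open>S = T\<close> gives (P)
  and \<open>S = H\<close> gives the subproblem with the constraints of \<open>H\<close>.\<close>

definition primal_inf ::
    "'a::{real_vector, topological_space} top_dual \<Rightarrow> ('t \<Rightarrow> 'a top_dual) \<Rightarrow> ('t \<Rightarrow> real) \<Rightarrow> 't set \<Rightarrow> ereal"
  where "primal_inf xs a b S =
    (INF x\<in>{x. \<forall>t\<in>S. pairing (a t) x \<le> b t}. ereal (pairing xs x))"

definition dual_vals_fin ::
    "'a::{real_vector, topological_space} top_dual \<Rightarrow> ('t \<Rightarrow> 'a top_dual) \<Rightarrow> ('t \<Rightarrow> real) \<Rightarrow> 't set \<Rightarrow> ereal set"
  where "dual_vals_fin xs a b H =
    {ereal (- (\<Sum>t\<in>H. \<mu> t * b t)) | \<mu>. \<mu> \<in> H \<rightarrow>\<^sub>E {0..} \<and> (\<Sum>t\<in>H. \<mu> t *\<^sub>R a t) = - xs}"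

definition dual_vals_family ::
    "'a::{real_vector, topological_space} top_dual \<Rightarrow> ('t \<Rightarrow> 'a top_dual) \<Rightarrow> ('t \<Rightarrow> real) \<Rightarrow> 't set set \<Rightarrow> ereal set"
  where "dual_vals_family xs a b \<H> = (\<Union>H\<in>\<H>. dual_vals_fin xs a b H)"

text \<open>The sums range over the support of \<open>\<lambda>\<close>, because \<^const>\<open>sum\<close> is 0 on every infinite
  index set.\<close>

definition dual_vals ::
    "'a::{real_vector, topological_space} top_dual \<Rightarrow> ('t \<Rightarrow> 'a top_dual) \<Rightarrow> ('t \<Rightarrow> real) \<Rightarrow> 't set \<Rightarrow> ereal set"
  where "dual_vals xs a b T =
    {ereal (- (\<Sum>t\<in>{t\<in>T. l t \<noteq> 0}. l t * b t)) | l.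
       l \<in> T \<rightarrow>\<^sub>E {0..} \<and> finite {t\<in>T. l t \<noteq> 0} \<and> (\<Sum>t\<in>{t\<in>T. l t \<noteq> 0}. l t *\<^sub>R a t) = - xs}"

definition is_max :: "ereal \<Rightarrow> ereal set \<Rightarrow> bool" where
  "is_max v V \<longleftrightarrow> v = Sup V \<and> v \<in> V"

definition K_family ::
    "('t \<Rightarrow> 'a::{real_vector, topological_space} top_dual) \<Rightarrow> ('t \<Rightarrow> real) \<Rightarrow> 't set set \<Rightarrow> ('a top_dual \<times> real) set"
  where "K_family a b \<H> = (\<Union>H\<in>\<H>. cone_co ((\<lambda>t. (a t, b t)) ` H + {0} \<times> {0..}))"

definition primal_reducible ::
    "'a::{real_vector, topological_space} top_dual \<Rightarrow> ('t \<Rightarrow> 'a top_dual) \<Rightarrow> ('t \<Rightarrow> real) \<Rightarrow> 't set \<Rightarrow> 't set set \<Rightarrow> bool"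
  where "primal_reducible xs a b T \<H> \<longleftrightarrow>
    (\<exists>H\<in>\<H>. primal_inf xs a b T = primal_inf xs a b H)"

definition dual_reducible ::
    "'a::{real_vector, topological_space} top_dual \<Rightarrow> ('t \<Rightarrow> 'a top_dual) \<Rightarrow> ('t \<Rightarrow> real) \<Rightarrow> 't set \<Rightarrow> 't set set \<Rightarrow> bool"
  where "dual_reducible xs a b T \<H> \<longleftrightarrow>
    (\<exists>H\<in>\<H>. Sup (dual_vals xs a b T) = Sup (dual_vals_fin xs a b H))"

end

theory Submission
  imports Defs
begin

text \<open>The equivalences rest on two facts about a finite index set \<open>H\<close>.

  Weak duality: a dual feasible multiplier bounds the primal value from below. Hence
  \<open>Sup (dual_vals_fin xs a b H) \<le> Sup (dual_vals_family xs a b \<H>) \<le> Sup (dual_vals xs a b T) \<le> \<alpha>\<close>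
  for \<open>H \<in> \<H>\<close>, and as soon as one dual value over some \<open>H\<close> reaches \<open>\<alpha>\<close>, the whole chain
  collapses, together with \<open>Sup (dual_vals_fin xs a b H) \<le> primal_inf xs a b H \<le> \<alpha>\<close>.

  Strong duality for finitely many constraints: if \<open>primal_inf xs a b H = \<alpha>\<close>, then some
  multiplier on \<open>H\<close> has a dual value \<open>\<ge> \<alpha>\<close>. This is the affine Farkas lemma. Since it
  involves only finitely many functionals, it is a fact of linear algebra: an induction on the
  number of functionals (Bartl's proof) gives the homogeneous Farkas lemma, and homogenization
  gives the affine one.

  Finally, the membership \<open>- (xs, \<alpha>) \<in> K_family a b \<H>\<close> yields a multiplier on some
  \<open>H \<in> \<H>\<close> that is dual feasible with value \<open>\<alpha> + r\<close>, where the slack \<open>r \<ge> 0\<close> comes from the factor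
  \<open>{0} \<times> {0..}\<close>; weak duality forces \<open>r = 0\<close>. Conversely, a multiplier of value \<open>\<alpha>\<close> gives,
  up to normalization, a convex combination of the generators.\<close>

section \<open>The dual pairing\<close>

lemma linear_pairing: "linear (pairing f)"
  using pairing[of f] by simp

lemma pairing_sum:
  "pairing (\<Sum>t\<in>F. \<mu> t *\<^sub>R a t) x = (\<Sum>t\<in>F. \<mu> t * pairing (a t) x)"
proof (induction F rule: infinite_finite_induct)
  case (insert t F)
  then show ?case
    by (simp add: plus_top_dual.rep_eq scaleR_top_dual.rep_eq)
qed (simp_all add: zero_top_dual.rep_eq)

lemma top_dual_eqI: "(\<And>x. pairing f x = pairing g x) \<Longrightarrow> f = g"
  by (simp add: pairing_inject[symmetric] fun_eq_iff)

section \<open>The Farkas lemma for finitely many functionals\<close>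

text \<open>In the induction step, either the new functional \<open>g s\<close> is superfluous, or there is a
  point \<open>x0\<close> with \<open>g s x0 = 1\<close> where the other constraints hold and \<open>f x0 > 0\<close>. Composing all
  functionals with the projection \<open>x \<mapsto> x - g s x *\<^sub>R x0\<close> onto the kernel of \<open>g s\<close> eliminates
  \<open>g s\<close>, and the signs at \<open>x0\<close> make the coefficient of \<open>g s\<close> nonnegative when the projection is
  undone.\<close>

lemma farkas_homogeneous:
  fixes f :: "'v::real_vector \<Rightarrow> real" and g :: "'i \<Rightarrow> 'v \<Rightarrow> real"
  assumes "finite H" "linear f" "\<And>t. t \<in> H \<Longrightarrow> linear (g t)"
    and "\<And>x. (\<And>t. t \<in> H \<Longrightarrow> g t x \<le> 0) \<Longrightarrow> f x \<le> 0"
  shows "\<exists>\<mu>. (\<forall>t\<in>H. 0 \<le> \<mu> t) \<and> (\<forall>x. f x = (\<Sum>t\<in>H. \<mu> t * g t x))"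
  using assms
proof (induction H arbitrary: f g rule: finite_induct)
  case empty
  have "f x = 0" for x
    using empty.prems(3)[of x] empty.prems(3)[of "- x"] linear_neg[OF empty.prems(1), of x]
    by simp
  then show ?case
    by simp
next
  case (insert s H)
  note lin = linear_add linear_diff linear_scale
  show ?case
  proof (cases "\<forall>x. (\<forall>t\<in>H. g t x \<le> 0) \<longrightarrow> f x \<le> 0")
    case True
    then obtain \<mu> where \<mu>: "\<forall>t\<in>H. 0 \<le> \<mu> t" "\<And>x. f x = (\<Sum>t\<in>H. \<mu> t * g t x)"
      using insert.IH[of f g] insert.prems by auto
    have "(\<Sum>t\<in>H. (\<mu>(s := 0)) t * g t x) = (\<Sum>t\<in>H. \<mu> t * g t x)" for x
      using insert.hyps by (intro sum.cong) auto
    then show ?thesis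
      using \<mu> insert.hyps by (intro exI[of _ "\<mu>(s := 0)"]) auto
  next
    case False
    then obtain x1 where x1: "\<And>t. t \<in> H \<Longrightarrow> g t x1 \<le> 0" "f x1 > 0"
      by force
    then have pos: "g s x1 > 0"
      using insert.prems(3)[of x1] by force
    define x0 where "x0 = (1 / g s x1) *\<^sub>R x1"
    have ls: "linear (g s)" and lt: "\<And>t. t \<in> H \<Longrightarrow> linear (g t)" and lf: "linear f"
      using insert.prems by auto
    have x0: "g s x0 = 1" "f x0 > 0" "\<And>t. t \<in> H \<Longrightarrow> g t x0 \<le> 0"
      using pos x1 by (auto simp: x0_def linear_scale[OF ls] linear_scale[OF lf]
          linear_scale[OF lt] divide_nonpos_pos)
    define f' where "f' x = f x - g s x * f x0" for x
    define g' where "g' t x = g t x - g s x * g t x0" for t x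
    have f': "f' x = f (x - g s x *\<^sub>R x0)" for x
      by (simp add: f'_def linear_diff[OF lf] linear_scale[OF lf])
    have g': "g' t x = g t (x - g s x *\<^sub>R x0)" if "t \<in> H" for t x
      by (simp add: g'_def linear_diff[OF lt[OF that]] linear_scale[OF lt[OF that]])
    have "f' x \<le> 0" if x: "\<And>t. t \<in> H \<Longrightarrow> g' t x \<le> 0" for x
    proof -
      have "g s (x - g s x *\<^sub>R x0) = 0"
        by (simp add: linear_diff[OF ls] linear_scale[OF ls] x0)
      then show ?thesis
        using x unfolding f' by (intro insert.prems(3)) (auto simp: g')
    qed
    moreover have "linear f'"
      using lf ls by (auto simp: f'_def linear_iff algebra_simps)
    moreover have "linear (g' t)" if "t \<in> H" for t
      using lt[OF that] ls by (auto simp: g'_def linear_iff algebra_simps)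
    ultimately obtain \<mu> where \<mu>: "\<forall>t\<in>H. 0 \<le> \<mu> t" "\<And>x. f' x = (\<Sum>t\<in>H. \<mu> t * g' t x)"
      using insert.IH[of f' g'] by auto
    define c where "c = f x0 - (\<Sum>t\<in>H. \<mu> t * g t x0)"
    have "(\<Sum>t\<in>H. \<mu> t * g t x0) \<le> 0"
      using \<mu>(1) x0(3) by (intro sum_nonpos) (simp add: mult_nonneg_nonpos)
    then have c: "c \<ge> 0"
      using x0(2) by (simp add: c_def)
    have "f x = c * g s x + (\<Sum>t\<in>H. \<mu> t * g t x)" for x
    proof -
      have "(\<Sum>t\<in>H. \<mu> t * g' t x) = (\<Sum>t\<in>H. \<mu> t * g t x) - g s x * (\<Sum>t\<in>H. \<mu> t * g t x0)"
        by (simp add: g'_def sum_subtractf sum_distrib_left right_diff_distrib mult.left_commute)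
      then show ?thesis
        using \<mu>(2)[of x] by (simp add: f'_def c_def algebra_simps)
    qed
    moreover have "(\<Sum>t\<in>H. (\<mu>(s := c)) t * g t x) = (\<Sum>t\<in>H. \<mu> t * g t x)" for x
      using insert.hyps by (intro sum.cong) auto
    ultimately show ?thesis
      using \<mu>(1) c insert.hyps by (intro exI[of _ "\<mu>(s := c)"]) auto
  qed
qed

text \<open>Homogenization: the homogeneous version is applied on \<open>'v \<times> real\<close> to the functionals
  \<open>(x, s) \<mapsto> g t x - b t * s\<close> together with \<open>(x, s) \<mapsto> - s\<close>, indexed by \<open>None\<close>. The feasible
  point is what controls the directions \<open>(x, 0)\<close>: along such a ray from it, \<open>f\<close> stays
  bounded below only if \<open>f x \<ge> 0\<close>.\<close>

lemma farkas_affine: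
  fixes f :: "'v::real_vector \<Rightarrow> real" and g :: "'i \<Rightarrow> 'v \<Rightarrow> real"
  assumes "finite H" "linear f" "\<And>t. t \<in> H \<Longrightarrow> linear (g t)"
    and feasible: "\<And>t. t \<in> H \<Longrightarrow> g t y \<le> b t"
    and bounded: "\<And>x. (\<And>t. t \<in> H \<Longrightarrow> g t x \<le> b t) \<Longrightarrow> \<alpha> \<le> f x"
  shows "\<exists>\<mu>. (\<forall>t\<in>H. 0 \<le> \<mu> t) \<and> (\<forall>x. (\<Sum>t\<in>H. \<mu> t * g t x) = - f x) \<and>
    \<alpha> \<le> - (\<Sum>t\<in>H. \<mu> t * b t)"
proof -
  define G where "G i p = (case i of None \<Rightarrow> - snd p | Some t \<Rightarrow> g t (fst p) - b t * snd p)"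
    for i and p :: "'v \<times> real"
  define F where "F p = \<alpha> * snd p - f (fst p)" for p :: "'v \<times> real"
  let ?I = "insert None (Some ` H)"
  have "linear F"
    using assms(2) by (auto simp: F_def linear_iff algebra_simps)
  moreover have "linear (G i)" if "i \<in> ?I" for i
    using that assms(3) by (auto simp: G_def linear_iff algebra_simps)
  moreover have "F p \<le> 0" if p: "\<And>i. i \<in> ?I \<Longrightarrow> G i p \<le> 0" for p
  proof -
    obtain x s where ps: "p = (x, s)"
      by (cases p)
    have s: "s \<ge> 0" and gx: "\<And>t. t \<in> H \<Longrightarrow> g t x \<le> b t * s"
      using p[of None] p[of "Some t" for t] by (auto simp: G_def ps)
    show ?thesis
    proof (cases "s = 0")
      case False
      then have sp: "s > 0"
        using s by simp
      have "g t ((1 / s) *\<^sub>R x) \<le> b t" if "t \<in> H" for t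
        using gx[OF that] sp by (simp add: linear_scale[OF assms(3)[OF that]] field_simps)
      then have "\<alpha> \<le> f ((1 / s) *\<^sub>R x)"
        by (rule bounded)
      then show ?thesis
        using sp by (simp add: F_def ps linear_scale[OF assms(2)] field_simps)
    next
      case True
      have "f x \<ge> 0"
      proof (rule ccontr)
        assume "\<not> f x \<ge> 0"
        then have neg: "f x < 0"
          by simp
        (* far enough along the ray to bring f down to at most \<alpha> - 1 *)
        define k where "k = (\<bar>f y - \<alpha>\<bar> + 1) / - f x"
        have k: "k \<ge> 0" "k * f x = - (\<bar>f y - \<alpha>\<bar> + 1)"
          using neg by (auto simp: k_def field_simps)
        have "g t (y + k *\<^sub>R x) \<le> b t" if "t \<in> H" for t
          using gx[OF that] feasible[OF that] True mult_nonneg_nonpos[OF k(1), of "g t x"]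
          by (simp add: linear_add[OF assms(3)[OF that]] linear_scale[OF assms(3)[OF that]])
        then have "\<alpha> \<le> f (y + k *\<^sub>R x)"
          by (rule bounded)
        then show False
          using k(2) by (simp add: linear_add[OF assms(2)] linear_scale[OF assms(2)])
      qed
      then show ?thesis
        by (simp add: F_def ps True)
    qed
  qed
  ultimately obtain m where m: "\<forall>i\<in>?I. 0 \<le> m i" "\<And>p. F p = (\<Sum>i\<in>?I. m i * G i p)"
    using farkas_homogeneous[of ?I F G] assms(1) by auto
  have F: "F (x, s) = - m None * s + (\<Sum>t\<in>H. m (Some t) * (g t x - b t * s))" for x s
    using m(2)[of "(x, s)"] assms(1) by (simp add: G_def sum.reindex)
  have "(\<Sum>t\<in>H. m (Some t) * g t x) = - f x" for x
    using F[of x 0] by (simp add: F_def)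
  moreover have "\<alpha> = - m None - (\<Sum>t\<in>H. m (Some t) * b t)"
    (* at (0, 1) only the right-hand sides b contribute *)
    using F[of 0 1] assms(2,3) by (simp add: F_def linear_0 sum_negf)
  ultimately show ?thesis
    using m(1) by (intro exI[of _ "\<lambda>t. m (Some t)"]) auto
qed

section \<open>Weak and strong duality\<close>

lemma weak_duality:
  fixes xs :: "'a::{real_vector, topological_space} top_dual"
  assumes "F \<subseteq> S" "\<And>t. t \<in> F \<Longrightarrow> 0 \<le> \<mu> t" "(\<Sum>t\<in>F. \<mu> t *\<^sub>R a t) = - xs"
  shows "ereal (- (\<Sum>t\<in>F. \<mu> t * b t)) \<le> primal_inf xs a b S"
  unfolding primal_inf_def
proof (rule INF_greatest)
  fix x assume x: "x \<in> {x. \<forall>t\<in>S. pairing (a t) x \<le> b t}"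
  have "(\<Sum>t\<in>F. \<mu> t * pairing (a t) x) \<le> (\<Sum>t\<in>F. \<mu> t * b t)"
    using x assms(1,2) by (intro sum_mono mult_left_mono) auto
  moreover have "(\<Sum>t\<in>F. \<mu> t * pairing (a t) x) = - pairing xs x"
    using pairing_sum[of \<mu> a F x] assms(3) by (simp add: uminus_top_dual.rep_eq)
  ultimately show "ereal (- (\<Sum>t\<in>F. \<mu> t * b t)) \<le> ereal (pairing xs x)"
    by simp
qed

lemma primal_inf_antimono: "H \<subseteq> S \<Longrightarrow> primal_inf xs a b H \<le> primal_inf xs a b S"
  unfolding primal_inf_def by (intro INF_superset_mono) auto

lemma dual_vals_fin_iff:
  "v \<in> dual_vals_fin xs a b H \<longleftrightarrow>
    (\<exists>\<mu>. (\<forall>t\<in>H. 0 \<le> \<mu> t) \<and> (\<Sum>t\<in>H. \<mu> t *\<^sub>R a t) = - xs \<and> v = ereal (- (\<Sum>t\<in>H. \<mu> t * b t)))"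
    (is "?L \<longleftrightarrow> ?R")
proof
  assume ?R
  then obtain \<mu> where "\<forall>t\<in>H. 0 \<le> \<mu> t" "(\<Sum>t\<in>H. \<mu> t *\<^sub>R a t) = - xs"
    "v = ereal (- (\<Sum>t\<in>H. \<mu> t * b t))"
    by blast
  then show ?L
    unfolding dual_vals_fin_def
    by (auto intro!: exI[of _ "restrict \<mu> H"])
next
  assume ?L
  then show ?R
    by (auto simp: dual_vals_fin_def PiE_iff)
qed

lemma Sup_dual_vals_fin_le: "Sup (dual_vals_fin xs a b H) \<le> primal_inf xs a b H"
  by (intro Sup_least) (auto simp: dual_vals_fin_iff intro!: weak_duality)

lemma Sup_dual_vals_le: "Sup (dual_vals xs a b T) \<le> primal_inf xs a b T"
  by (intro Sup_least) (auto simp: dual_vals_def PiE_iff intro!: weak_duality)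

text \<open>A multiplier on \<open>H\<close> is extended by 0 to \<open>T\<close>.\<close>

lemma dual_vals_fin_subset_dual_vals:
  assumes "finite H" "H \<subseteq> T"
  shows "dual_vals_fin xs a b H \<subseteq> dual_vals xs a b T"
proof
  fix v assume "v \<in> dual_vals_fin xs a b H"
  then obtain \<mu> where \<mu>: "\<forall>t\<in>H. 0 \<le> \<mu> t" "(\<Sum>t\<in>H. \<mu> t *\<^sub>R a t) = - xs"
    "v = ereal (- (\<Sum>t\<in>H. \<mu> t * b t))"
    by (auto simp: dual_vals_fin_iff)
  define l where "l = (\<lambda>t\<in>T. if t \<in> H then \<mu> t else 0)"
  let ?S = "{t \<in> T. l t \<noteq> 0}"
  have sub: "?S \<subseteq> H"
    by (auto simp: l_def)
  have "(\<Sum>t\<in>?S. l t * b t) = (\<Sum>t\<in>H. \<mu> t * b t)"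
    using assms by (intro sum.mono_neutral_cong_left sub) (auto simp: l_def)
  moreover have "(\<Sum>t\<in>?S. l t *\<^sub>R a t) = (\<Sum>t\<in>H. \<mu> t *\<^sub>R a t)"
    using assms by (intro sum.mono_neutral_cong_left sub) (auto simp: l_def)
  moreover have "l \<in> T \<rightarrow>\<^sub>E {0..}"
    using \<mu>(1) by (auto simp: l_def)
  ultimately show "v \<in> dual_vals xs a b T"
    using \<mu> finite_subset[OF sub assms(1)] unfolding dual_vals_def by (auto intro!: exI[of _ l])
qed

text \<open>The affine Farkas lemma gives a multiplier of value at least \<open>\<alpha>\<close>; weak duality turns this
  into equality, so the dual supremum is attained.\<close>

lemma strong_duality_finite:
  fixes xs :: "'a::{real_vector, topological_space} top_dual"
  assumes "finite H" "primal_inf xs a b H = ereal \<alpha>"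
  shows "ereal \<alpha> \<in> dual_vals_fin xs a b H"
proof -
  have "{x. \<forall>t\<in>H. pairing (a t) x \<le> b t} \<noteq> {}"
    (* an infeasible problem has value +\<infinity> *)
  proof
    assume "{x. \<forall>t\<in>H. pairing (a t) x \<le> b t} = {}"
    then have "primal_inf xs a b H = \<infinity>"
      by (simp only: primal_inf_def INF_empty top_ereal_def)
    then show False
      using assms(2) by simp
  qed
  then obtain y where y: "\<And>t. t \<in> H \<Longrightarrow> pairing (a t) y \<le> b t"
    by auto
  have "\<alpha> \<le> pairing xs x" if "\<And>t. t \<in> H \<Longrightarrow> pairing (a t) x \<le> b t" for x
  proof -
    have "primal_inf xs a b H \<le> ereal (pairing xs x)"
      unfolding primal_inf_def using that by (intro INF_lower) auto
    then show ?thesis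
      using assms(2) by simp
  qed
  then obtain \<mu> where \<mu>: "\<forall>t\<in>H. 0 \<le> \<mu> t" "\<And>x. (\<Sum>t\<in>H. \<mu> t * pairing (a t) x) = - pairing xs x"
    "\<alpha> \<le> - (\<Sum>t\<in>H. \<mu> t * b t)"
    using farkas_affine[of H "pairing xs" "\<lambda>t. pairing (a t)" y b \<alpha>] assms(1) linear_pairing y
    by blast
  have eq: "(\<Sum>t\<in>H. \<mu> t *\<^sub>R a t) = - xs"
    by (rule top_dual_eqI) (simp add: pairing_sum \<mu>(2) uminus_top_dual.rep_eq)
  have "ereal (- (\<Sum>t\<in>H. \<mu> t * b t)) \<le> ereal \<alpha>"
    using weak_duality[of H H \<mu> a xs b] \<mu>(1) eq assms(2) by auto
  then show ?thesis
    using \<mu> eq by (auto simp: dual_vals_fin_iff intro!: exI[of _ \<mu>])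
qed

section \<open>Multipliers and the conical hull of the constraint data\<close>

text \<open>The pairs \<open>(p, q)\<close> that satisfy the conclusion form a convex cone that contains the
  generators. The inequality in the conclusion is the reason why this is not an equivalence: for
  \<open>r > 0\<close> the vertical vector \<open>(0, r)\<close> satisfies it with \<open>\<mu> = 0\<close>, but if no combination of the
  \<open>a t\<close> with nonnegative, not all zero coefficients vanishes, then \<open>(0, r)\<close> is only the limit of
  \<open>\<epsilon> *\<^sub>R (a t, b t + r / \<epsilon>)\<close> for \<open>\<epsilon> \<rightarrow> 0\<close> and lies outside the conical hull.\<close>

lemma cone_co_epigraph_imp_multiplier:
  assumes "finite H" "(p, q) \<in> cone_co ((\<lambda>t. (a t, b t)) ` H + {0} \<times> {0..})"
  shows "\<exists>\<mu>. (\<forall>t\<in>H. 0 \<le> \<mu> t) \<and> (\<Sum>t\<in>H. \<mu> t *\<^sub>R a t) = p \<and> (\<Sum>t\<in>H. \<mu> t * b t) \<le> (q::real)"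
proof -
  define C where "C = {z. \<exists>\<mu>. (\<forall>t\<in>H. (0::real) \<le> \<mu> t) \<and> (\<Sum>t\<in>H. \<mu> t *\<^sub>R a t) = fst z \<and>
    (\<Sum>t\<in>H. \<mu> t * b t) \<le> snd z}"
  have cone: "c *\<^sub>R z \<in> C" if "z \<in> C" "c \<ge> 0" for c z
  proof -
    from that obtain \<mu> where "\<forall>t\<in>H. 0 \<le> \<mu> t" "(\<Sum>t\<in>H. \<mu> t *\<^sub>R a t) = fst z"
      "(\<Sum>t\<in>H. \<mu> t * b t) \<le> snd z"
      by (auto simp: C_def)
    moreover have "(\<Sum>t\<in>H. (c * \<mu> t) *\<^sub>R a t) = c *\<^sub>R (\<Sum>t\<in>H. \<mu> t *\<^sub>R a t)"
      by (simp add: scaleR_sum_right)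
    moreover have "(\<Sum>t\<in>H. c * \<mu> t * b t) = c * (\<Sum>t\<in>H. \<mu> t * b t)"
      by (simp add: sum_distrib_left mult.assoc)
    ultimately show ?thesis
      using that(2) by (auto simp: C_def mult_left_mono intro!: exI[of _ "\<lambda>t. c * \<mu> t"])
  qed
  have add: "z + w \<in> C" if "z \<in> C" "w \<in> C" for z w
  proof -
    from that obtain \<mu> \<nu> where "\<forall>t\<in>H. 0 \<le> \<mu> t" "(\<Sum>t\<in>H. \<mu> t *\<^sub>R a t) = fst z"
      "(\<Sum>t\<in>H. \<mu> t * b t) \<le> snd z" "\<forall>t\<in>H. 0 \<le> \<nu> t" "(\<Sum>t\<in>H. \<nu> t *\<^sub>R a t) = fst w"
      "(\<Sum>t\<in>H. \<nu> t * b t) \<le> snd w"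
      by (auto simp: C_def)
    then show ?thesis
      by (auto simp: C_def sum.distrib scaleR_add_left distrib_right
          intro!: exI[of _ "\<lambda>t. \<mu> t + \<nu> t"])
  qed
  have "convex C"
    unfolding convex_def using cone add by blast
  moreover have "(\<lambda>t. (a t, b t)) ` H + {0} \<times> {0..} \<subseteq> C"
  proof
    fix z assume "z \<in> (\<lambda>t. (a t, b t)) ` H + {0} \<times> {0..}"
    then obtain t r where z: "t \<in> H" "r \<ge> 0" "z = (a t, b t + r)"
      by (auto elim!: set_plus_elim)
    have "(\<Sum>s\<in>H. (if s = t then 1 else 0) *\<^sub>R a s) = a t"
      "(\<Sum>s\<in>H. (if s = t then 1 else 0) * b s) = b t"
      using assms(1) z(1) by (simp_all add: if_distrib[of "\<lambda>c. c *\<^sub>R _"]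
          if_distrib[of "\<lambda>c. c * _"] cong: if_cong)
    then show "z \<in> C"
      using z by (auto simp: C_def intro!: exI[of _ "\<lambda>s. if s = t then 1 else 0"])
  qed
  ultimately have "convex hull ((\<lambda>t. (a t, b t)) ` H + {0} \<times> {0..}) \<subseteq> C"
    by (rule hull_minimal[rotated])
  then have "(p, q) \<in> C"
    using assms(2) cone unfolding cone_co_def by auto
  then show ?thesis
    by (simp add: C_def)
qed

text \<open>If \<open>\<mu>\<close> does not vanish, then dividing by its total mass gives a convex combination of
  generators. If \<open>\<mu> = 0\<close>, then the pair is the apex, which is in the cone because \<open>H\<close> is nonempty.\<close>

lemma multiplier_imp_cone_co_epigraph:
  assumes "finite H" "H \<noteq> {}" "\<forall>t\<in>H. 0 \<le> \<mu> t"
  shows "(\<Sum>t\<in>H. \<mu> t *\<^sub>R a t, \<Sum>t\<in>H. \<mu> t * b t)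
    \<in> cone_co ((\<lambda>t. (a t, b t :: real)) ` H + {0} \<times> {0..})"
proof -
  let ?A = "(\<lambda>t. (a t, b t)) ` H + {0} \<times> {0..}"
  let ?z = "(\<Sum>t\<in>H. \<mu> t *\<^sub>R a t, \<Sum>t\<in>H. \<mu> t * b t)"
  have gen: "(a t, b t) \<in> convex hull ?A" if "t \<in> H" for t
  proof -
    have "(a t, b t) + (0, 0) \<in> ?A"
      using that by (intro set_plus_intro) auto
    then show ?thesis
      by (simp add: hull_inc)
  qed
  have z: "?z = (\<Sum>t\<in>H. \<mu> t *\<^sub>R (a t, b t))"
    by (simp add: prod_eq_iff fst_sum snd_sum)
  define M where "M = (\<Sum>t\<in>H. \<mu> t)"
  show ?thesis
  proof (cases "M = 0")
    case True
    then have "\<forall>t\<in>H. \<mu> t = 0"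
      using assms by (simp add: M_def sum_nonneg_eq_0_iff)
    then have "?z = 0"
      by (simp add: zero_prod_def)
    moreover obtain t where "t \<in> H"
      using assms(2) by blast
    ultimately have "?z = 0 *\<^sub>R (a t, b t)" "(a t, b t) \<in> convex hull ?A"
      using gen by (simp_all add: zero_prod_def)
    then show ?thesis
      unfolding cone_co_def by (metis (mono_tags, lifting) mem_Collect_eq order_refl)
  next
    case False
    then have M: "M > 0"
      using assms(3) by (metis M_def sum_nonneg less_eq_real_def)
    have "(\<Sum>t\<in>H. (\<mu> t / M) *\<^sub>R (a t, b t)) \<in> convex hull ?A"
      using assms M gen by (intro convex_sum) (auto simp: M_def simp flip: sum_divide_distrib)
    moreover have "?z = M *\<^sub>R (\<Sum>t\<in>H. (\<mu> t / M) *\<^sub>R (a t, b t))"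
      unfolding z scaleR_sum_right using M by (intro sum.cong) auto
    ultimately show ?thesis
      using M unfolding cone_co_def by (metis (mono_tags, lifting) mem_Collect_eq less_imp_le)
  qed
qed

section \<open>Equivalence of strong duality and reducibility\<close>

theorem corollary4p1:
  fixes xs :: "'a::locally_convex_t2 top_dual"
    and a :: "'t \<Rightarrow> 'a top_dual"
    and b :: "'t \<Rightarrow> real"
    and T :: "'t set"
    and \<H> :: "'t set set"
    and \<alpha> :: real
  assumes "infinite T"
    and "\<H> \<noteq> {}"
    and "\<H> \<subseteq> fin_nonempty_subsets T"
    and "primal_inf xs a b T = ereal \<alpha>"
    and "\<forall>H\<in>\<H>. \<exists>y. \<forall>t\<in>H. pairing (a t) y < b t"
  shows "(- (xs, \<alpha>) \<in> K_family a b \<H>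
            \<longleftrightarrow> is_max (ereal \<alpha>) (dual_vals_family xs a b \<H>))
       \<and> (is_max (ereal \<alpha>) (dual_vals_family xs a b \<H>)
            \<longleftrightarrow> dual_reducible xs a b T \<H> \<and> ereal \<alpha> = Sup (dual_vals_family xs a b \<H>))
       \<and> (dual_reducible xs a b T \<H> \<and> ereal \<alpha> = Sup (dual_vals_family xs a b \<H>)
            \<longleftrightarrow> primal_reducible xs a b T \<H>)
       \<and> (ereal \<alpha> = Sup (dual_vals_family xs a b \<H>) \<longrightarrow> ereal \<alpha> = Sup (dual_vals xs a b T))"
proof -
  have H: "finite H" "H \<noteq> {}" "H \<subseteq> T" if "H \<in> \<H>" for H
    using that assms(3) by (auto simp: fin_nonempty_subsets_def)
  have D_le: "Sup (dual_vals xs a b T) \<le> ereal \<alpha>"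
    using Sup_dual_vals_le[of xs a b T] assms(4) by simp
  have "dual_vals_family xs a b \<H> \<subseteq> dual_vals xs a b T"
    unfolding dual_vals_family_def
    by (intro UN_least dual_vals_fin_subset_dual_vals H(1,3))
  then have DH_le: "Sup (dual_vals_family xs a b \<H>) \<le> Sup (dual_vals xs a b T)"
    by (rule Sup_subset_mono)
  have max_iff: "is_max (ereal \<alpha>) (dual_vals_family xs a b \<H>) \<longleftrightarrow>
      (\<exists>H\<in>\<H>. ereal \<alpha> \<in> dual_vals_fin xs a b H)"
  proof -
    have "ereal \<alpha> = Sup (dual_vals_family xs a b \<H>)"
      if "ereal \<alpha> \<in> dual_vals_family xs a b \<H>"
      using Sup_upper[OF that] D_le DH_le by simp
    then show ?thesis
      unfolding is_max_def by (auto simp: dual_vals_family_def)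
  qed
  have i_ii: "- (xs, \<alpha>) \<in> K_family a b \<H>
      \<longleftrightarrow> is_max (ereal \<alpha>) (dual_vals_family xs a b \<H>)" (is "?i \<longleftrightarrow> ?ii")
  proof
    assume ?i
    then obtain H where HH: "H \<in> \<H>"
      and "(- xs, - \<alpha>) \<in> cone_co ((\<lambda>t. (a t, b t)) ` H + {0} \<times> {0..})"
      by (auto simp: K_family_def)
    then obtain \<mu> where \<mu>: "\<forall>t\<in>H. 0 \<le> \<mu> t" "(\<Sum>t\<in>H. \<mu> t *\<^sub>R a t) = - xs"
      "(\<Sum>t\<in>H. \<mu> t * b t) \<le> - \<alpha>"
      using cone_co_epigraph_imp_multiplier[of H "- xs" "- \<alpha>" a b] H by blast
    (* weak duality rules out a strict inequality in the last fact *)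
    have "ereal (- (\<Sum>t\<in>H. \<mu> t * b t)) \<le> ereal \<alpha>"
      using weak_duality[of H T \<mu> a xs b] \<mu> H[OF HH] assms(4) by auto
    then have "ereal \<alpha> \<in> dual_vals_fin xs a b H"
      using \<mu> by (auto simp: dual_vals_fin_iff intro!: exI[of _ \<mu>])
    then show ?ii
      using HH max_iff by blast
  next
    assume ?ii
    then obtain H \<mu> where HH: "H \<in> \<H>" and \<mu>: "\<forall>t\<in>H. 0 \<le> \<mu> t" "(\<Sum>t\<in>H. \<mu> t *\<^sub>R a t) = - xs"
      "\<alpha> = - (\<Sum>t\<in>H. \<mu> t * b t)"
      by (auto simp: max_iff dual_vals_fin_iff)
    then have "- (xs, \<alpha>) = (\<Sum>t\<in>H. \<mu> t *\<^sub>R a t, \<Sum>t\<in>H. \<mu> t * b t)"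
      by simp
    then show ?i
      using multiplier_imp_cone_co_epigraph[of H \<mu> a b] H[OF HH] \<mu>(1) HH
      unfolding K_family_def by auto
  qed
  have ii_iii: "dual_reducible xs a b T \<H> \<and> ereal \<alpha> = Sup (dual_vals_family xs a b \<H>)" if ?ii
  proof
    from that show *: "ereal \<alpha> = Sup (dual_vals_family xs a b \<H>)"
      by (simp add: is_max_def)
    from that obtain H where HH: "H \<in> \<H>" "ereal \<alpha> \<in> dual_vals_fin xs a b H"
      by (auto simp: max_iff)
    have "Sup (dual_vals_fin xs a b H) \<le> Sup (dual_vals_family xs a b \<H>)"
      using HH(1) by (intro Sup_subset_mono) (auto simp: dual_vals_family_def)
    then have "Sup (dual_vals_fin xs a b H) = Sup (dual_vals xs a b T)"
      using Sup_upper[OF HH(2)] * D_le DH_le by simp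
    then show "dual_reducible xs a b T \<H>"
      unfolding dual_reducible_def using HH(1) by (intro bexI[of _ H]) simp_all
  qed
  have iii_iv: "primal_reducible xs a b T \<H>"
    if "dual_reducible xs a b T \<H>" "ereal \<alpha> = Sup (dual_vals_family xs a b \<H>)"
  proof -
    from that(1) obtain H where HH: "H \<in> \<H>"
      and eq: "Sup (dual_vals xs a b T) = Sup (dual_vals_fin xs a b H)"
      by (auto simp: dual_reducible_def)
    have "ereal \<alpha> \<le> primal_inf xs a b H"
      using that(2) DH_le eq Sup_dual_vals_fin_le[of xs a b H] by simp
    then have "primal_inf xs a b T = primal_inf xs a b H"
      using primal_inf_antimono[OF H(3)[OF HH], of xs a b] assms(4) by simp
    then show ?thesis
      using HH by (auto simp: primal_reducible_def)
  qed
  have iv_ii: ?ii if "primal_reducible xs a b T \<H>"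
    using that strong_duality_finite H(1) assms(4) unfolding primal_reducible_def max_iff
    by metis
  have "ereal \<alpha> = Sup (dual_vals xs a b T)" if "ereal \<alpha> = Sup (dual_vals_family xs a b \<H>)"
    using that D_le DH_le by simp
  then show ?thesis
    using i_ii ii_iii iii_iv iv_ii by blast
qed

end
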